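(* Any (randomized) algorithm that, given {\textsc{COND-EVAL}} access to an unknown distribution $D$ on $[n]$, approximates the support size $|\mathrm{supp}(D)|$ within a multiplicative $4/3$-factor with probability at least $2/3$, must make $\Omega(\log\log\log n)$ queries.
   Context: $[n]=\{1,\dots,n\}$. For a distribution $D$ on $[n]$ and $S\subseteq[n]$, $D(S)=\sum_{i\in S}D(i)$, and $\mathrm{supp}(D)=\{x: D(x)>0\}$. A {\textsc{COND-EVAL}} oracle for $D$ takes as input any set $S\subseteq[n]$ (possibly chosen adaptively); if $D(S)>0$ it returns $(j,D(j),D(j)/D(S))$ where $j\in S$ is drawn with probability $D(j)/D(S)$, and if $D(S)=0$ it returns "failure". An estimate $N$ is within a multiplicative $4/3$-factor if $\frac34|\mathrm{supp}(D)|\le N\le\frac43|\mathrm{supp}(D)|$. The guarantee must hold for every distribution $D$ on $[n]$. *)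

theory Defs
  imports "HOL-Probability.Probability"
begin

definition distributions_on :: "nat \<Rightarrow> nat pmf set" where
  "distributions_on n = {D. set_pmf D \<subseteq> {1..n}}"

text \<open>An oracle answer; \<open>None\<close> stands for ``failure''.\<close>
type_synonym answer = "(nat \<times> real \<times> real) option"

definition cond_eval :: "nat pmf \<Rightarrow> nat set \<Rightarrow> answer pmf" where
  "cond_eval D S =
     (if measure_pmf.prob D S > 0
      then map_pmf (\<lambda>j. Some (j, pmf D j, pmf D j / measure_pmf.prob D S)) (cond_pmf D S)
      else return_pmf None)"

text \<open>
  Randomized adaptive query algorithms, as (well-founded) decision trees: stop with an estimate,
  query a set and continue depending on the answer, or toss coins. The generated set function
  \<open>queried\<close> collects all inputs to the oracle occurring in the tree.
\<close>
datatype (queried: 's) algorithm =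
    Output real
  | Query 's "answer \<Rightarrow> 's algorithm"
  | Random "'s algorithm pmf"

text \<open>
  The joint distribution of the number of queries made and the estimate returned when the
  algorithm is executed with oracle access to \<open>D\<close>; each oracle call uses fresh randomness.
\<close>
primrec run :: "nat pmf \<Rightarrow> nat set algorithm \<Rightarrow> (nat \<times> real) pmf" where
  "run D (Output N) = return_pmf (0, N)"
| "run D (Query S k) =
     bind_pmf (cond_eval D S) (\<lambda>r. map_pmf (\<lambda>(q, N). (Suc q, N)) (run D (k r)))"
| "run D (Random p) = join_pmf (map_pmf (run D) p)"

definition algorithm_on :: "nat \<Rightarrow> nat set algorithm \<Rightarrow> bool" where
  "algorithm_on n A \<longleftrightarrow> queried A \<subseteq> Pow {1..n}"

definition approximates_support_size :: "nat \<Rightarrow> nat set algorithm \<Rightarrow> bool" where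
  "approximates_support_size n A \<longleftrightarrow>
     (\<forall>D\<in>distributions_on n.
        measure_pmf.prob (run D A)
          {(q, N). 3 / 4 * real (card (set_pmf D)) \<le> N \<and> N \<le> 4 / 3 * real (card (set_pmf D))}
        \<ge> 2 / 3)"

text \<open>Worst case over the distribution, the oracle's answers and the internal coins.\<close>
definition makes_at_most_queries :: "nat \<Rightarrow> nat set algorithm \<Rightarrow> nat \<Rightarrow> bool" where
  "makes_at_most_queries n A m \<longleftrightarrow>
     (\<forall>D\<in>distributions_on n. \<forall>(q, N)\<in>set_pmf (run D A). q \<le> m)"

end

theory Submission
  imports Defs
begin

text \<open>
  For a scale \<open>s\<close>, take the support \<open>{1..s}\<close> with rapidly decreasing integer weights (up to
  normalisation), each chosen uniformly from an interval much longer than the sum of all later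
  weights. Conditional samples then almost always return the minimum of the queried set, so the
  answers are determined by the weights. Suppose that after some queries every element of \<open>{s<..t}\<close>
  has the same membership pattern in the queried sets as some element of \<open>{1..s}\<close>. Then the weight
  vectors of scale \<open>s\<close> embed into those of scale \<open>t\<close> with the same answers: subtract the new
  weights from older ones with the same pattern. Hence a transcript of \<open>m\<close> queries separates the
  scales into few classes of almost equal likelihood, and summing the success probabilities over the
  scales \<open>2 ^ i \<le> n\<close>, whose sets of admissible outputs are disjoint, gives
  \<open>ln n \<le> 4 * (4 ^ m + 1) ^ m\<close>.
\<close>

section \<open>Replacing random oracle answers by greedy ones\<close>

lemma integrable_measure_pmf_unit:
  fixes f :: "'a \<Rightarrow> real"
  assumes "\<And>x. 0 \<le> f x" "\<And>x. f x \<le> 1"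
  shows "integrable (measure_pmf p) f"
  using assms by (intro measure_pmf.integrable_const_bound[where B = 1]) auto

lemma prob_bind_pmf:
  "measure_pmf.prob (bind_pmf p f) X = measure_pmf.expectation p (\<lambda>x. measure_pmf.prob (f x) X)"
proof -
  have "ennreal (measure_pmf.prob (bind_pmf p f) X)
      = (\<integral>\<^sup>+ x. ennreal (measure_pmf.prob (f x) X) \<partial>measure_pmf p)"
    by (simp add: emeasure_bind_pmf flip: measure_pmf.emeasure_eq_measure)
  also have "\<dots> = ennreal (measure_pmf.expectation p (\<lambda>x. measure_pmf.prob (f x) X))"
    by (intro nn_integral_eq_integral integrable_measure_pmf_unit) auto
  finally show ?thesis
    by (simp add: integral_nonneg_AE)
qed

text \<open>The likeliest answer when each element of the support outweighs all larger ones together.\<close>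

definition greedy_answer :: "nat pmf \<Rightarrow> nat set \<Rightarrow> answer" where
  "greedy_answer D S =
     (if measure_pmf.prob D S > 0
      then Some (Min (S \<inter> set_pmf D), pmf D (Min (S \<inter> set_pmf D)),
                 pmf D (Min (S \<inter> set_pmf D)) / measure_pmf.prob D S)
      else None)"

text \<open>
  The probability of an output in \<open>E\<close> after at most \<open>m\<close> queries, only the algorithm's own coins
  being random.
\<close>

primrec greedy_success :: "nat pmf \<Rightarrow> real set \<Rightarrow> nat set algorithm \<Rightarrow> nat \<Rightarrow> real" where
  "greedy_success D E (Output N) = (\<lambda>m. indicator E N)"
| "greedy_success D E (Query S k) =
     (\<lambda>m. case m of 0 \<Rightarrow> 0 | Suc m' \<Rightarrow> greedy_success D E (k (greedy_answer D S)) m')"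
| "greedy_success D E (Random p) =
     (\<lambda>m. measure_pmf.expectation (map_pmf (greedy_success D E) p) (\<lambda>f. f m))"

lemma greedy_success_bounds: "0 \<le> greedy_success D E A m \<and> greedy_success D E A m \<le> 1"
proof (induction A arbitrary: m)
  case (Random p)
  have "AE A in measure_pmf p. norm (greedy_success D E A m) \<le> 1"
    using Random by (auto simp: AE_measure_pmf_iff)
  then have "integrable (measure_pmf p) (\<lambda>A. greedy_success D E A m)"
    by (intro measure_pmf.integrable_const_bound) auto
  then have "measure_pmf.expectation p (\<lambda>A. greedy_success D E A m) \<le> 1"
    using Random by (intro measure_pmf.integral_le_const) (auto simp: AE_measure_pmf_iff)
  moreover have "0 \<le> measure_pmf.expectation p (\<lambda>A. greedy_success D E A m)"
    using Random by (intro integral_nonneg_AE) (auto simp: AE_measure_pmf_iff)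
  ultimately show ?case by simp
qed (auto split: nat.split simp: indicator_def)

lemmas greedy_success_nonneg = greedy_success_bounds[THEN conjunct1]
lemmas greedy_success_le_1 = greedy_success_bounds[THEN conjunct2]

text \<open>A query bound speaks only of runs of positive probability; this carries it over to the
  branches in which all answers are greedy.\<close>

lemma greedy_answer_in_cond_eval:
  assumes "finite (set_pmf D)"
  shows "greedy_answer D S \<in> set_pmf (cond_eval D S)"
proof (cases "measure_pmf.prob D S > 0")
  case True
  then have ne: "set_pmf D \<inter> S \<noteq> {}"
    by (metis Int_commute less_irrefl measure_Int_set_pmf measure_empty)
  then have "Min (S \<inter> set_pmf D) \<in> S \<inter> set_pmf D"
    using assms by (intro Min_in) auto
  then have "Min (S \<inter> set_pmf D) \<in> set_pmf (cond_pmf D S)"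
    using ne by (subst set_cond_pmf) auto
  then show ?thesis using True by (auto simp: greedy_answer_def cond_eval_def)
qed (simp add: greedy_answer_def cond_eval_def)

lemma prob_cond_eval_not_greedy:
  assumes fin: "finite (set_pmf D)" and "0 \<le> \<theta>"
    and dom: "\<And>S. 0 < measure_pmf.prob D S \<Longrightarrow>
        (1 - \<theta>) * measure_pmf.prob D S \<le> pmf D (Min (S \<inter> set_pmf D))"
  shows "measure_pmf.prob (cond_eval D S) (- {greedy_answer D S}) \<le> \<theta>"
proof (cases "measure_pmf.prob D S > 0")
  case True
  define j where "j = Min (S \<inter> set_pmf D)"
  from True have ne: "set_pmf D \<inter> S \<noteq> {}"
    by (metis Int_commute less_irrefl measure_Int_set_pmf measure_empty)
  then have j: "j \<in> S \<inter> set_pmf D"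
    using fin unfolding j_def by (intro Min_in) auto
  have "measure_pmf.prob (cond_eval D S) (- {greedy_answer D S})
      \<le> measure_pmf.prob (cond_pmf D S) (- {j})"
    using True unfolding cond_eval_def
    by (auto simp: greedy_answer_def j_def measure_map_pmf intro!: measure_pmf.finite_measure_mono)
  also have "\<dots> = 1 - pmf (cond_pmf D S) j"
    using measure_pmf.prob_compl[of "{j}" "cond_pmf D S"]
    by (simp add: Compl_eq_Diff_UNIV measure_pmf_single)
  also have "\<dots> = 1 - pmf D j / measure_pmf.prob D S"
    using ne j by (simp add: pmf_cond)
  also have "\<dots> \<le> \<theta>"
    using dom[OF True] True by (simp add: j_def field_simps)
  finally show ?thesis .
next
  case False
  then show ?thesis using \<open>0 \<le> \<theta>\<close>
    by (simp add: cond_eval_def greedy_answer_def measure_return_pmf)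
qed

text \<open>A union bound: each of the at most \<open>m\<close> queries leaves the greedy branch
  with probability at most \<theta>.\<close>

lemma success_le_greedy_success:
  assumes fin: "finite (set_pmf D)" and "0 \<le> \<theta>"
    and dom: "\<And>S. 0 < measure_pmf.prob D S \<Longrightarrow>
        (1 - \<theta>) * measure_pmf.prob D S \<le> pmf D (Min (S \<inter> set_pmf D))"
    and "\<forall>(q, N)\<in>set_pmf (run D A). q \<le> m"
  shows "measure_pmf.prob (run D A) {(q, N). N \<in> E} \<le> greedy_success D E A m + real m * \<theta>"
  using assms(4)
proof (induction A arbitrary: m)
  case (Output N)
  then show ?case using \<open>0 \<le> \<theta>\<close> by (simp add: measure_return_pmf indicator_def)
next
  case (Query S k)
  define r0 where "r0 = greedy_answer D S"
  define f where "f r = measure_pmf.prob (run D (k r)) {(q, N). N \<in> E}" for r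
  have r0: "r0 \<in> set_pmf (cond_eval D S)"
    unfolding r0_def by (rule greedy_answer_in_cond_eval[OF fin])
  have le: "Suc q \<le> m" if "(q, N) \<in> set_pmf (run D (k r0))" for q N
    using Query.prems r0 that by force
  \<comment> \<open>Some run exists below \<open>r0\<close>, and together with the present query it
    forces \<open>m\<close> to be positive.\<close>
  obtain q N where "(q, N) \<in> set_pmf (run D (k r0))"
    using set_pmf_not_empty by (metis equals0I surj_pair)
  with le obtain m' where m': "m = Suc m'" by (meson Suc_le_D)
  have "measure_pmf.prob (run D (Query S k)) {(q, N). N \<in> E}
      = measure_pmf.expectation (cond_eval D S) f"
    by (simp add: prob_bind_pmf f_def[abs_def] measure_map_pmf vimage_def case_prod_unfold)
  also have "\<dots> \<le> measure_pmf.expectation (cond_eval D S) (\<lambda>r. f r0 + indicator (- {r0}) r)"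
    by (intro integral_mono integrable_measure_pmf_unit Bochner_Integration.integrable_add)
       (auto simp: f_def indicator_def intro: order_trans[OF measure_pmf.prob_le_1])
  also have "\<dots> = f r0 + measure_pmf.prob (cond_eval D S) (- {r0})"
    by (subst Bochner_Integration.integral_add) (auto intro: integrable_measure_pmf_unit)
  also have "\<dots> \<le> f r0 + \<theta>"
    unfolding r0_def using prob_cond_eval_not_greedy[OF fin \<open>0 \<le> \<theta>\<close> dom] by simp
  also have "f r0 \<le> greedy_success D E (k r0) m' + real m' * \<theta>"
    unfolding f_def using le m' by (intro Query.IH) auto
  finally show ?case by (simp add: m' r0_def algebra_simps)
next
  case (Random p)
  have "measure_pmf.prob (run D (Random p)) {(q, N). N \<in> E}
      = measure_pmf.expectation p (\<lambda>A. measure_pmf.prob (run D A) {(q, N). N \<in> E})"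
    by (simp add: join_eq_bind_pmf prob_bind_pmf)
  also have "\<dots> \<le> measure_pmf.expectation p (\<lambda>A. greedy_success D E A m + real m * \<theta>)"
  proof (intro integral_mono_AE)
    show "AE A in measure_pmf p. measure_pmf.prob (run D A) {(q, N). N \<in> E}
        \<le> greedy_success D E A m + real m * \<theta>"
      unfolding AE_measure_pmf_iff
    proof
      fix A assume "A \<in> set_pmf p"
      then show "measure_pmf.prob (run D A) {(q, N). N \<in> E} \<le> greedy_success D E A m + real m * \<theta>"
        using Random.prems by (intro Random.IH) (auto simp: join_eq_bind_pmf)
    qed
  qed (auto intro!: integrable_measure_pmf_unit Bochner_Integration.integrable_add
        simp: greedy_success_bounds)
  also have "\<dots> = greedy_success D E (Random p) m + real m * \<theta>"
    by (subst Bochner_Integration.integral_add)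
       (auto intro!: integrable_measure_pmf_unit simp: greedy_success_bounds)
  finally show ?case .
qed

text \<open>The coins depend neither on the scale nor on the weights, so the expectation commutes
  with both sums and a bound for every subtree averages out.\<close>

lemma greedy_success_Random_sum:
  assumes "finite C" "\<And>s. s \<in> C \<Longrightarrow> finite (X s)"
    and "\<And>A. A \<in> set_pmf p \<Longrightarrow> (\<Sum>s\<in>C. \<Sum>x\<in>X s. greedy_success (D s x) (E s) A m) \<le> B"
  shows "(\<Sum>s\<in>C. \<Sum>x\<in>X s. greedy_success (D s x) (E s) (Random p) m) \<le> B"
proof -
  have int: "integrable (measure_pmf p) (\<lambda>A. greedy_success (D s x) (E s) A m)" for s x
    by (intro integrable_measure_pmf_unit greedy_success_nonneg greedy_success_le_1)
  have "(\<Sum>s\<in>C. \<Sum>x\<in>X s. greedy_success (D s x) (E s) (Random p) m)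
      = measure_pmf.expectation p (\<lambda>A. \<Sum>s\<in>C. \<Sum>x\<in>X s. greedy_success (D s x) (E s) A m)"
    using int by (simp add: Bochner_Integration.integral_sum Bochner_Integration.integrable_sum)
  also have "\<dots> \<le> B"
    using assms(3) int
    by (intro measure_pmf.integral_le_const) (auto simp: AE_measure_pmf_iff)
  finally show ?thesis .
qed

section \<open>Hard distributions with rapidly decreasing weights\<close>

locale hidden_tail =
  fixes n :: nat and M :: int
  assumes n_pos: "1 \<le> n" and M_ge: "4 \<le> M"
begin

text \<open>
  The margin \<open>4 * k\<close> leaves room for \<open>k\<close> successive applications of \<open>shift\<close> below, each of which
  lowers a coordinate by at most \<open>4 * M ^ (n - i)\<close>.
\<close>

definition box :: "nat \<Rightarrow> (nat \<Rightarrow> int) set" where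
  "box k = (\<Pi>\<^sub>E i\<in>{2..n}. {(M + 4 * int k) * M ^ (n - i)..<2 * M * M ^ (n - i)})"

text \<open>Element 1 takes up the slack so that the total is always \<open>2 * M ^ n\<close>.\<close>

definition weight :: "nat \<Rightarrow> (nat \<Rightarrow> int) \<Rightarrow> nat \<Rightarrow> int" where
  "weight s x i = (if i = 1 then 2 * M ^ n - (\<Sum>l\<in>{2..s}. x l) else if i \<in> {2..s} then x i else 0)"

definition hard :: "nat \<Rightarrow> (nat \<Rightarrow> int) \<Rightarrow> nat pmf" where
  "hard s x = embed_pmf (\<lambda>i. real_of_int (weight s x i) / real_of_int (2 * M ^ n))"

lemma finite_box: "finite (box k)"
  unfolding box_def by (intro finite_PiE) auto

lemma box_antimono:
  assumes "k \<le> k'"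
  shows "box k' \<subseteq> box k"
proof -
  have "(M + 4 * int k) * M ^ (n - i) \<le> (M + 4 * int k') * M ^ (n - i)" for i
    using assms M_ge by (intro mult_right_mono) auto
  then show ?thesis unfolding box_def by (intro PiE_mono ivl_subset[THEN iffD2] disjI2) simp
qed

lemma box_lower: "x \<in> box k \<Longrightarrow> i \<in> {2..n} \<Longrightarrow> (M + 4 * int k) * M ^ (n - i) \<le> x i"
  and box_upper: "x \<in> box k \<Longrightarrow> i \<in> {2..n} \<Longrightarrow> x i < 2 * M * M ^ (n - i)"
  unfolding box_def by (drule (1) PiE_mem; simp)+

lemma box_ge:
  assumes "x \<in> box k" "i \<in> {2..n}"
  shows "M * M ^ (n - i) \<le> x i"
proof -
  have "M * M ^ (n - i) \<le> (M + 4 * int k) * M ^ (n - i)"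
    using M_ge by (intro mult_right_mono) auto
  then show ?thesis using box_lower[OF assms] by (rule order_trans)
qed

lemma box_nonneg: "x \<in> box k \<Longrightarrow> i \<in> {2..n} \<Longrightarrow> 0 \<le> x i"
  using M_ge by (intro order_trans[OF _ box_ge[of x k i]]) simp_all

lemma geometric_tail: "i \<le> n \<Longrightarrow> (\<Sum>l\<in>{i<..n}. 2 * M * M ^ (n - l)) \<le> 4 * M ^ (n - i)"
proof (induction i rule: inc_induct)
  case (step i)
  have "{i<..n} = insert (Suc i) {Suc i<..n}" using step.hyps by auto
  then have "(\<Sum>l\<in>{i<..n}. 2 * M * M ^ (n - l)) \<le> (2 * M + 4) * M ^ (n - Suc i)"
    using step.IH by (simp add: algebra_simps)
  also have "\<dots> \<le> (4 * M) * M ^ (n - Suc i)"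
    using M_ge by (intro mult_right_mono) auto
  also have "\<dots> = 4 * M ^ (n - i)"
    using step.hyps by (simp add: Suc_diff_Suc flip: power_Suc)
  finally show ?case .
qed simp

text \<open>One estimate with three uses: element 1 keeps a large weight, the minimum of a queried
  set dominates the set, and \<open>shift\<close> costs at most one level of margin.\<close>

lemma box_tail_sum:
  assumes x: "x \<in> box k" and A: "A \<subseteq> {2..n}" "A \<subseteq> {i<..}" and "i \<le> n"
  shows "(\<Sum>l\<in>A. x l) \<le> 4 * M ^ (n - i)"
proof -
  have fin: "finite A" using A(1) finite_subset by blast
  have "(\<Sum>l\<in>A. x l) \<le> (\<Sum>l\<in>A. 2 * M * M ^ (n - l))"
    using box_upper[OF x] A by (intro sum_mono less_imp_le) blast
  also have "\<dots> \<le> (\<Sum>l\<in>{i<..n}. 2 * M * M ^ (n - l))"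
    using A M_ge by (intro sum_mono2) fastforce+
  also have "\<dots> \<le> 4 * M ^ (n - i)" by (rule geometric_tail[OF \<open>i \<le> n\<close>])
  finally show ?thesis .
qed

lemma weight_ge:
  assumes x: "x \<in> box k" and "s \<le> n" "i \<in> {1..s}"
  shows "M * M ^ (n - i) \<le> weight s x i"
proof (cases "i = 1")
  case True
  \<comment> \<open>The total is \<open>2 * M * M ^ (n - 1)\<close>, and the other weights take at
    most half of it.\<close>
  have "(\<Sum>l\<in>{2..s}. x l) \<le> 4 * M ^ (n - 1)"
    using assms n_pos by (intro box_tail_sum[OF x]) auto
  moreover have "4 * M ^ (n - 1) \<le> M * M ^ (n - 1)"
    using M_ge by (intro mult_right_mono) auto
  moreover have "M ^ n = M * M ^ (n - 1)"
    using n_pos by (simp flip: power_Suc)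
  ultimately show ?thesis using True by (simp add: weight_def)
next
  case False
  then show ?thesis using assms box_ge[OF x, of i] by (simp add: weight_def)
qed

lemma weight_pos:
  assumes "x \<in> box k" "s \<le> n" "i \<in> {1..s}"
  shows "0 < weight s x i"
  using M_ge by (intro less_le_trans[OF _ weight_ge[OF assms]]) auto

lemma weight_eq_0: "1 \<le> s \<Longrightarrow> i \<notin> {1..s} \<Longrightarrow> weight s x i = 0"
  by (auto simp: weight_def)

lemma weight_total: "1 \<le> s \<Longrightarrow> (\<Sum>i\<in>{1..s}. weight s x i) = 2 * M ^ n"
proof -
  assume "1 \<le> s"
  then have "{1..s} = insert 1 {2..s}" by auto
  then show ?thesis by (simp add: weight_def)
qed

context
  fixes k s :: nat and x :: "nat \<Rightarrow> int"
  assumes x: "x \<in> box k" and s: "1 \<le> s" "s \<le> n"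
begin

lemma weight_nonneg: "0 \<le> weight s x i"
  using weight_pos[OF x s(2), of i] weight_eq_0[OF s(1), of i x] by (cases "i \<in> {1..s}") auto

lemma hard_density_nonneg: "0 \<le> real_of_int (weight s x i) / real_of_int (2 * M ^ n)"
  using weight_nonneg[of i] M_ge by simp

lemma nn_integral_hard_density:
  "(\<integral>\<^sup>+ i. ennreal (real_of_int (weight s x i) / real_of_int (2 * M ^ n)) \<partial>count_space UNIV) = 1"
proof -
  have "(\<integral>\<^sup>+ i. ennreal (real_of_int (weight s x i) / real_of_int (2 * M ^ n)) \<partial>count_space UNIV)
      = (\<Sum>i\<in>{1..s}. ennreal (real_of_int (weight s x i) / real_of_int (2 * M ^ n)))"
    using weight_eq_0[OF s(1)] by (intro nn_integral_count_space') auto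
  also have "\<dots> = ennreal (\<Sum>i\<in>{1..s}. real_of_int (weight s x i) / real_of_int (2 * M ^ n))"
    using hard_density_nonneg by (intro sum_ennreal) auto
  also have "(\<Sum>i\<in>{1..s}. real_of_int (weight s x i) / real_of_int (2 * M ^ n))
      = real_of_int (\<Sum>i\<in>{1..s}. weight s x i) / real_of_int (2 * M ^ n)"
    by (simp add: sum_divide_distrib)
  also have "\<dots> = 1" using weight_total[OF s(1)] M_ge by simp
  finally show ?thesis by simp
qed

lemma pmf_hard: "pmf (hard s x) i = real_of_int (weight s x i) / real_of_int (2 * M ^ n)"
  unfolding hard_def by (rule pmf_embed_pmf[OF hard_density_nonneg nn_integral_hard_density])

lemma set_pmf_hard: "set_pmf (hard s x) = {1..s}"
proof -
  have "weight s x i \<noteq> 0 \<longleftrightarrow> i \<in> {1..s}" for i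
    using weight_pos[OF x s(2), of i] weight_eq_0[OF s(1), of i x] by fastforce
  then show ?thesis
    using M_ge by (intro set_eqI) (simp add: set_pmf_iff pmf_hard del: atLeastAtMost_iff)
qed

lemma prob_hard:
  "measure_pmf.prob (hard s x) S
    = real_of_int (\<Sum>i\<in>S \<inter> {1..s}. weight s x i) / real_of_int (2 * M ^ n)"
proof -
  have "measure_pmf.prob (hard s x) S = measure_pmf.prob (hard s x) (S \<inter> {1..s})"
    using measure_Int_set_pmf[of "hard s x" S] by (simp add: set_pmf_hard)
  also have "\<dots> = (\<Sum>i\<in>S \<inter> {1..s}. pmf (hard s x) i)"
    by (intro measure_measure_pmf_finite) auto
  also have "\<dots> = real_of_int (\<Sum>i\<in>S \<inter> {1..s}. weight s x i) / real_of_int (2 * M ^ n)"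
    by (simp add: pmf_hard sum_divide_distrib)
  finally show ?thesis .
qed

lemma prob_hard_pos_iff: "0 < measure_pmf.prob (hard s x) S \<longleftrightarrow> S \<inter> {1..s} \<noteq> {}"
  using measure_pmf_zero_iff[of "hard s x" S]
  unfolding set_pmf_hard zero_less_measure_iff by (simp add: Int_commute)

text \<open>Above its minimum \<open>j\<close> in the support, \<open>S\<close> weighs at most
  \<open>4 * M ^ (n - j)\<close>, whereas \<open>j\<close> alone weighs at least
  \<open>M * M ^ (n - j)\<close>.\<close>

lemma hard_dominated:
  assumes "0 < measure_pmf.prob (hard s x) S"
  shows "(1 - 4 / real_of_int M) * measure_pmf.prob (hard s x) S
    \<le> pmf (hard s x) (Min (S \<inter> set_pmf (hard s x)))"
proof -
  define j where "j = Min (S \<inter> {1..s})"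
  have ne: "S \<inter> {1..s} \<noteq> {}" using assms prob_hard_pos_iff by simp
  have j: "j \<in> S \<inter> {1..s}" unfolding j_def using ne by (intro Min_in) auto
  define T where "T = S \<inter> {1..s} - {j}"
  have T_gt: "j < l" if "l \<in> T" for l
  proof -
    have "j \<le> l" unfolding j_def using that by (intro Min_le) (auto simp: T_def)
    then show ?thesis using that by (auto simp: T_def)
  qed
  have split: "S \<inter> {1..s} = insert j T" "j \<notin> T" "finite T" using j by (auto simp: T_def)
  have "(\<Sum>i\<in>T. weight s x i) = (\<Sum>i\<in>T. x i)"
    using j T_gt by (intro sum.cong refl) (fastforce simp: weight_def T_def)
  also have "\<dots> \<le> 4 * M ^ (n - j)"
    using j s T_gt by (intro box_tail_sum[OF x]) (fastforce simp: T_def)+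
  finally have "real_of_int (\<Sum>i\<in>T. weight s x i) \<le> real_of_int (4 * M ^ (n - j))"
    by (simp only: of_int_le_iff)
  also have "\<dots> = 4 / real_of_int M * real_of_int (M * M ^ (n - j))"
    using M_ge by simp
  also have "\<dots> \<le> 4 / real_of_int M * real_of_int (weight s x j)"
    using weight_ge[OF x s(2), of j] j M_ge
    by (intro mult_left_mono) (simp_all only: of_int_le_iff, auto)
  finally have tail: "real_of_int (\<Sum>i\<in>T. weight s x i) \<le> 4 / real_of_int M * real_of_int (weight s x j)" .
  define \<theta> where "\<theta> = 4 / real_of_int M"
  have \<theta>: "0 \<le> \<theta>" "\<theta> \<le> 1" using M_ge by (auto simp: \<theta>_def)
  \<comment> \<open>The tail is absorbed because the product of 1 - \<theta> and 1 + \<theta> is at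
    most 1.\<close>
  have "(1 - \<theta>) * real_of_int (\<Sum>i\<in>S \<inter> {1..s}. weight s x i)
      \<le> (1 - \<theta>) * ((1 + \<theta>) * real_of_int (weight s x j))"
    using tail \<theta> unfolding split(1) using split(2,3)
    by (intro mult_left_mono) (auto simp: \<theta>_def algebra_simps)
  also have "\<dots> = (1 - \<theta>\<^sup>2) * real_of_int (weight s x j)"
    by (simp add: algebra_simps power2_eq_square)
  also have "\<dots> \<le> 1 * real_of_int (weight s x j)"
    using weight_nonneg[of j] by (intro mult_right_mono) auto
  finally have "(1 - \<theta>) * real_of_int (\<Sum>i\<in>S \<inter> {1..s}. weight s x i) / real_of_int (2 * M ^ n)
      \<le> real_of_int (weight s x j) / real_of_int (2 * M ^ n)"
    using M_ge by (intro divide_right_mono) auto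
  then show ?thesis by (simp add: prob_hard pmf_hard set_pmf_hard j_def \<theta>_def)
qed

end

section \<open>Embedding a smaller scale into a larger one\<close>

text \<open>
  Elements with equal signature are interchangeable for the greedy answers to the queries in \<open>h\<close>:
  these depend only on the weights of the sets \<open>S\<close> and \<open>{Min S}\<close>.
\<close>

definition signature :: "nat set list \<Rightarrow> nat \<Rightarrow> (bool \<times> bool) list" where
  "signature h i = map (\<lambda>S. (i \<in> S, i = Min (S \<inter> {1..n}))) h"

text \<open>
  Enlarging the support from \<open>{1..s}\<close> to \<open>{1..t}\<close> adds weights, which are compensated at older elements
  \<open>\<rho> l\<close> of the same signature. (Element 1 compensates automatically.)
\<close>

definition shift :: "nat \<Rightarrow> nat \<Rightarrow> (nat \<Rightarrow> nat) \<Rightarrow> (nat \<Rightarrow> int) \<Rightarrow> nat \<Rightarrow> int" where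
  "shift s t \<rho> x i = (if i \<in> {2..s} then x i - (\<Sum>l\<in>{l \<in> {s<..t}. \<rho> l = i}. x l) else x i)"

text \<open>Element 1 is the delicate case: its slack loses the whole new tail, and the shifts on
  \<open>{2..s}\<close> give back all of it except the part that \<rho> sends to 1.\<close>

lemma weight_shift_le:
  assumes "1 \<le> s" "s \<le> t" and \<rho>: "\<rho> ` {s<..t} \<subseteq> {1..s}" and "i \<in> {1..s}"
  shows "weight t (shift s t \<rho> x) i = weight s x i - (\<Sum>l\<in>{l \<in> {s<..t}. \<rho> l = i}. x l)"
proof (cases "i = 1")
  case True
  let ?F = "\<lambda>i. \<Sum>l\<in>{l \<in> {s<..t}. \<rho> l = i}. x l"
  have "{2..t} = {2..s} \<union> {s<..t}" using assms(1,2) by auto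
  then have "(\<Sum>l\<in>{2..t}. shift s t \<rho> x l)
      = (\<Sum>l\<in>{2..s}. shift s t \<rho> x l) + (\<Sum>l\<in>{s<..t}. shift s t \<rho> x l)"
    by (simp only:) (rule sum.union_disjoint, auto)
  also have "(\<Sum>l\<in>{2..s}. shift s t \<rho> x l) = (\<Sum>l\<in>{2..s}. x l) - (\<Sum>i\<in>{2..s}. ?F i)"
    by (simp add: shift_def sum_subtractf)
  also have "(\<Sum>l\<in>{s<..t}. shift s t \<rho> x l) = (\<Sum>l\<in>{s<..t}. x l)"
    by (intro sum.cong) (auto simp: shift_def)
  also have "\<dots> = (\<Sum>i\<in>{1..s}. ?F i)"
    using \<rho> by (intro sum.group[symmetric]) auto
  also have "{1..s} = insert 1 {2..s}" using \<open>1 \<le> s\<close> by auto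
  finally show ?thesis using True by (simp add: weight_def)
next
  case False
  then show ?thesis using assms by (simp add: weight_def shift_def)
qed

text \<open>A new element \<open>l\<close> adds to \<open>Q\<close> exactly what was removed from
  \<open>Q\<close> at its partner \<rho> \<open>l\<close>.\<close>

lemma sum_weight_shift:
  assumes "1 \<le> s" "s \<le> t" and \<rho>: "\<rho> ` {s<..t} \<subseteq> {1..s}"
    and Q: "\<And>l. l \<in> {s<..t} \<Longrightarrow> \<rho> l \<in> Q \<longleftrightarrow> l \<in> Q"
  shows "(\<Sum>i\<in>Q \<inter> {1..t}. weight t (shift s t \<rho> x) i) = (\<Sum>i\<in>Q \<inter> {1..s}. weight s x i)"
proof -
  let ?F = "\<lambda>i. {l \<in> {s<..t}. \<rho> l = i}"
  have "Q \<inter> {1..t} = Q \<inter> {1..s} \<union> Q \<inter> {s<..t}" using assms(1,2) by auto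
  then have "(\<Sum>i\<in>Q \<inter> {1..t}. weight t (shift s t \<rho> x) i)
     = (\<Sum>i\<in>Q \<inter> {1..s}. weight t (shift s t \<rho> x) i) + (\<Sum>i\<in>Q \<inter> {s<..t}. weight t (shift s t \<rho> x) i)"
    by (simp only:) (rule sum.union_disjoint, auto)
  also have "(\<Sum>i\<in>Q \<inter> {s<..t}. weight t (shift s t \<rho> x) i) = (\<Sum>i\<in>Q \<inter> {s<..t}. x i)"
    using assms(1,2) by (intro sum.cong) (auto simp: weight_def shift_def)
  also have "\<dots> = (\<Sum>i\<in>Q \<inter> {1..s}. \<Sum>l\<in>{l \<in> Q \<inter> {s<..t}. \<rho> l = i}. x l)"
    using \<rho> Q by (intro sum.group[symmetric]) auto
  also have "\<dots> = (\<Sum>i\<in>Q \<inter> {1..s}. sum x (?F i))"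
    using Q by (intro sum.cong refl) auto
  also have "(\<Sum>i\<in>Q \<inter> {1..s}. weight t (shift s t \<rho> x) i)
      = (\<Sum>i\<in>Q \<inter> {1..s}. weight s x i - sum x (?F i))"
    using weight_shift_le[OF assms(1-3)] by (intro sum.cong) auto
  finally show ?thesis by (simp add: sum_subtractf)
qed

lemma shift_in_box:
  assumes x: "x \<in> box (Suc k)" and st: "s \<le> t" "t \<le> n"
  shows "shift s t \<rho> x \<in> box k"
  unfolding box_def
proof (rule PiE_I)
  fix i assume i: "i \<in> {2..n}"
  define a d u where "a = (M + 4 * int k) * M ^ (n - i)" and "d = 4 * M ^ (n - i)"
    and "u = 2 * M * M ^ (n - i)"
  have d: "0 \<le> d" unfolding d_def using M_ge by simp
  have "(M + 4 * int (Suc k)) * M ^ (n - i) = a + d"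
    by (simp add: a_def d_def algebra_simps)
  then have bounds: "a + d \<le> x i" "x i < u"
    using box_lower[OF x i] box_upper[OF x i] by (simp_all only: u_def)
  have "shift s t \<rho> x i \<in> {a..<u}"
  proof (cases "i \<in> {2..s}")
    case True
    let ?F = "{l \<in> {s<..t}. \<rho> l = i}"
    have F: "?F \<subseteq> {2..n}" "?F \<subseteq> {i<..}" using st True by auto
    have "sum x ?F \<le> d"
      unfolding d_def using i F by (intro box_tail_sum[OF x]) auto
    moreover have "0 \<le> sum x ?F"
      using F box_nonneg[OF x] by (intro sum_nonneg) blast
    ultimately show ?thesis using bounds True by (simp add: shift_def)
  next
    case False
    then show ?thesis using bounds d by (auto simp: shift_def)
  qed
  then show "shift s t \<rho> x i \<in> {(M + 4 * int k) * M ^ (n - i)..<2 * M * M ^ (n - i)}"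
    by (simp only: a_def u_def)
next
  fix i assume i: "i \<notin> {2..n}"
  have "x i = undefined" using x i unfolding box_def by (rule PiE_arb)
  moreover have "i \<notin> {2..s}" using i st by auto
  ultimately show "shift s t \<rho> x i = undefined" by (auto simp: shift_def)
qed

text \<open>Coordinates outside \<open>{2..s}\<close> are unchanged, and they determine the amounts
  subtracted inside.\<close>

lemma inj_shift: "inj (shift s t \<rho>)"
proof (rule injI)
  fix x y assume eq: "shift s t \<rho> x = shift s t \<rho> y"
  have above: "x l = y l" if "l \<notin> {2..s}" for l
    using fun_cong[OF eq, of l] that by (auto simp: shift_def)
  have "x i = y i" for i
  proof (cases "i \<in> {2..s}")
    case True
    have "(\<Sum>l\<in>{l \<in> {s<..t}. \<rho> l = i}. x l) = (\<Sum>l\<in>{l \<in> {s<..t}. \<rho> l = i}. y l)"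
      by (intro sum.cong above) auto
    then show ?thesis using fun_cong[OF eq, of i] True by (simp add: shift_def)
  qed (rule above)
  then show "x = y" ..
qed

text \<open>Equal signatures mean that \<rho> respects both \<open>S\<close> and the singleton of
  its minimum, so \<open>sum_weight_shift\<close> preserves both weights that the answer
  reports.\<close>

lemma greedy_answer_shift:
  assumes x: "x \<in> box (Suc k)" and st: "1 \<le> s" "s \<le> t" "t \<le> n"
    and \<rho>: "\<rho> ` {s<..t} \<subseteq> {1..s}"
    and sig: "\<And>l. l \<in> {s<..t} \<Longrightarrow> signature h (\<rho> l) = signature h l"
    and S: "S \<in> set h"
  shows "greedy_answer (hard t (shift s t \<rho> x)) S = greedy_answer (hard s x) S"
proof -
  let ?y = "shift s t \<rho> x"
  have y: "?y \<in> box k" using shift_in_box[OF x st(2,3)] .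
  have t1: "1 \<le> t" and sn: "s \<le> n" using st by auto
  have inS: "\<rho> l \<in> S \<longleftrightarrow> l \<in> S" and isMin: "\<rho> l = Min (S \<inter> {1..n}) \<longleftrightarrow> l = Min (S \<inter> {1..n})"
    if "l \<in> {s<..t}" for l
    using sig[OF that] S by (auto simp: signature_def)
  have probs: "measure_pmf.prob (hard t ?y) S = measure_pmf.prob (hard s x) S"
    using sum_weight_shift[OF st(1,2) \<rho> inS]
    by (simp add: prob_hard[OF y t1 st(3)] prob_hard[OF x st(1) sn])
  show ?thesis
  proof (cases "S \<inter> {1..s} = {}")
    case True
    then have "measure_pmf.prob (hard s x) S = 0" by (simp add: prob_hard[OF x st(1) sn])
    then show ?thesis using probs by (simp add: greedy_answer_def)
  next
    case False
    define j where "j = Min (S \<inter> {1..n})"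
    \<comment> \<open>Once \<open>S\<close> meets \<open>{1..s}\<close>, its minimum in any larger
      support is its minimum in \<open>{1..n}\<close>; hence \<open>signature\<close> can be defined
      independently of the scale.\<close>
    have least: "Min (S \<inter> {1..u}) = j" if "s \<le> u" "u \<le> n" for u
    proof -
      have *: "Min (S \<inter> {1..u}) \<in> S \<inter> {1..u}" using False that by (intro Min_in) auto
      show ?thesis unfolding j_def
      proof (rule Min_eqI[symmetric])
        fix i assume i: "i \<in> S \<inter> {1..n}"
        show "Min (S \<inter> {1..u}) \<le> i"
          using i * by (cases "i \<le> u") (auto intro: Min_le)
      qed (use * that in auto)
    qed
    have j: "j \<in> {1..s}"
      using least[of s] sn Min_in[of "S \<inter> {1..s}"] False by auto
    have "(\<Sum>i\<in>{j} \<inter> {1..t}. weight t ?y i) = (\<Sum>i\<in>{j} \<inter> {1..s}. weight s x i)"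
      using isMin by (intro sum_weight_shift[OF st(1,2) \<rho>]) (auto simp: j_def)
    then have "weight t ?y j = weight s x j" using j st by simp
    then have "pmf (hard t ?y) j = pmf (hard s x) j"
      by (simp add: pmf_hard[OF y t1 st(3)] pmf_hard[OF x st(1) sn])
    then show ?thesis
      using probs least st
      by (simp add: greedy_answer_def set_pmf_hard[OF y t1 st(3)] set_pmf_hard[OF x st(1) sn])
  qed
qed

section \<open>Counting weight vectors by transcript\<close>

text \<open>The cardinality is, up to normalisation, the likelihood of a transcript under uniform
  weights; the transcript lists the latest query first.\<close>

definition consistent :: "nat \<Rightarrow> nat \<Rightarrow> nat set list \<Rightarrow> answer list \<Rightarrow> (nat \<Rightarrow> int) set" where
  "consistent s k h rs = {x \<in> box k. map (greedy_answer (hard s x)) h = rs}"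

lemma finite_consistent: "finite (consistent s k h rs)"
  unfolding consistent_def using finite_box by simp

text \<open>Sending each new element to an old one of equal signature makes \<open>shift\<close> an
  injection that preserves the transcript and costs one level of margin.\<close>

lemma card_consistent_le:
  assumes st: "1 \<le> s" "s \<le> t" "t \<le> n"
    and sig: "signature h ` {1..s} = signature h ` {1..t}"
  shows "card (consistent s (Suc k) h rs) \<le> card (consistent t k h rs)"
proof -
  have "\<exists>i\<in>{1..s}. signature h i = signature h l" if "l \<in> {s<..t}" for l
  proof -
    have "signature h l \<in> signature h ` {1..s}" unfolding sig using that by auto
    then show ?thesis by (metis imageE)
  qed
  then obtain \<rho> where \<rho>: "\<And>l. l \<in> {s<..t} \<Longrightarrow> \<rho> l \<in> {1..s} \<and> signature h (\<rho> l) = signature h l"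
    by metis
  have "shift s t \<rho> ` consistent s (Suc k) h rs \<subseteq> consistent t k h rs"
  proof
    fix y assume "y \<in> shift s t \<rho> ` consistent s (Suc k) h rs"
    then obtain x where x: "x \<in> box (Suc k)" "map (greedy_answer (hard s x)) h = rs"
      and y: "y = shift s t \<rho> x" by (auto simp: consistent_def)
    have "map (greedy_answer (hard t y)) h = map (greedy_answer (hard s x)) h"
      unfolding y using \<rho> by (intro map_cong refl greedy_answer_shift[OF x(1) st]) auto
    then show "y \<in> consistent t k h rs"
      using x y shift_in_box[OF x(1) st(2,3)] by (simp add: consistent_def)
  qed
  then show ?thesis
    using inj_shift finite_consistent by (intro card_inj_on_le) (auto simp: inj_on_def dest: injD)
qed

lemma card_signature_le: "card (signature h ` X) \<le> 4 ^ length h"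
proof -
  have "card (signature h ` X) \<le> card {l :: (bool \<times> bool) list. set l \<subseteq> UNIV \<and> length l = length h}"
    by (intro card_mono finite_lists_length_eq) (auto simp: signature_def)
  also have "\<dots> = 4 ^ length h" by (subst card_lists_length_eq) simp_all
  finally show ?thesis .
qed

lemma consistent_Cons:
  "consistent s k (S # h) (r # rs) = {x \<in> consistent s k h rs. greedy_answer (hard s x) S = r}"
  by (auto simp: consistent_def)

lemma sum_card_consistent_Cons:
  assumes "finite R" "(\<lambda>x. greedy_answer (hard s x) S) ` box k \<subseteq> R"
  shows "(\<Sum>r\<in>R. card (consistent s k (S # h) (r # rs))) = card (consistent s k h rs)"
proof -
  have "(\<Sum>r\<in>R. \<Sum>x\<in>{x \<in> consistent s k h rs. greedy_answer (hard s x) S = r}. 1::nat)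
      = (\<Sum>x\<in>consistent s k h rs. 1)"
    using assms finite_consistent by (intro sum.group) (auto simp: consistent_def)
  then show ?thesis by (simp add: consistent_Cons)
qed

text \<open>
  A further query refines the signatures, and the scales in \<open>C\<close> fall into at most \<open>4 ^ L + 1\<close> classes
  according to the number of signatures that occur in \<open>{1..s}\<close>. Scales in the same class give each
  transcript almost the same number of weight vectors, so they jointly count only once.
\<close>

lemma sum_greedy_success_le:
  assumes "disjoint_family_on E C" "C \<subseteq> {1..t}" "t \<le> n"
    "\<And>s. s \<in> C \<Longrightarrow> signature h ` {1..s} = signature h ` {1..t}" "length h + m \<le> L"
  shows "(\<Sum>s\<in>C. \<Sum>x\<in>consistent s (k + m + 1) h rs. greedy_success (hard s x) (E s) A m)
    \<le> (4 ^ L + 1) ^ m * real (card (consistent t k h rs))"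
  using assms
proof (induction A arbitrary: C t h rs k m)
  case (Output N)
  have fin: "finite C" using Output.prems(2) finite_subset by blast
  have "(\<Sum>s\<in>C. \<Sum>x\<in>consistent s (k + m + 1) h rs. greedy_success (hard s x) (E s) (Output N) m)
      = (\<Sum>s\<in>C. real (card (consistent s (k + m + 1) h rs)) * indicator (E s) N)"
    by simp
  also have "\<dots> \<le> real (card (consistent t k h rs))"
  \<comment> \<open>By disjointness \<open>N\<close> is admissible for at most one scale, whose
    count is then compared with that of \<open>t\<close>.\<close>
  proof (cases "\<exists>s\<in>C. N \<in> E s")
    case True
    then obtain s where s: "s \<in> C" "N \<in> E s" by blast
    have other: "N \<notin> E s'" if "s' \<in> C" "s' \<noteq> s" for s'
      using Output.prems(1) s that unfolding disjoint_family_on_def by blast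
    have "(\<Sum>s\<in>C. real (card (consistent s (k + m + 1) h rs)) * indicator (E s) N)
        = (\<Sum>s\<in>{s}. real (card (consistent s (k + m + 1) h rs)) * indicator (E s) N)"
      using fin s other by (intro sum.mono_neutral_right) auto
    also have "\<dots> = real (card (consistent s (k + m + 1) h rs))" using s by simp
    \<comment> \<open>The comparison needs only one level; margin kept for queries not made is given
      up.\<close>
    also have "\<dots> \<le> real (card (consistent s (Suc k) h rs))"
      using box_antimono[of "Suc k" "k + m + 1"] finite_consistent
      by (intro of_nat_mono card_mono) (auto simp: consistent_def)
    also have "\<dots> \<le> real (card (consistent t k h rs))"
      using Output.prems s by (intro of_nat_mono card_consistent_le) auto
    finally show ?thesis .
  qed simp
  also have "\<dots> \<le> (4 ^ L + 1) ^ m * real (card (consistent t k h rs))"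
    by (simp add: mult_le_cancel_right1)
  finally show ?case .
next
  case (Query S q)
  have fin: "finite C" using Query.prems(2) finite_subset by blast
  show ?case
  proof (cases m)
    case 0
    then show ?thesis by simp
  next
    case (Suc m')
    \<comment> \<open>The sets of signatures increase with \<open>s\<close>, so among the scales
      their cardinality already determines them.\<close>
    define \<kappa> where "\<kappa> s = card (signature (S # h) ` {1..s})" for s
    define G where "G s = (\<Sum>x\<in>consistent s (k + m + 1) h rs.
        greedy_success (hard s x) (E s) (Query S q) m)" for s
    let ?B = "4 ^ L + 1 :: real"
    have class_le: "(\<Sum>s\<in>{s \<in> C. \<kappa> s = c}. G s) \<le> ?B ^ m' * real (card (consistent t k h rs))" for c
    proof (cases "{s \<in> C. \<kappa> s = c} = {}")
      case False
      define C' where "C' = {s \<in> C. \<kappa> s = c}"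
      define t' where "t' = Max C'"
      have fin': "finite C'" and sub: "C' \<subseteq> C" using fin by (auto simp: C'_def)
      have t': "t' \<in> C'" unfolding t'_def using fin' False by (intro Max_in) (auto simp: C'_def)
      have max: "s \<le> t'" if "s \<in> C'" for s unfolding t'_def using fin' that by simp
      have sig: "signature (S # h) ` {1..s} = signature (S # h) ` {1..t'}" if "s \<in> C'" for s
      proof (rule card_subset_eq)
        show "signature (S # h) ` {1..s} \<subseteq> signature (S # h) ` {1..t'}"
          using max[OF that] by (intro image_mono) auto
        show "card (signature (S # h) ` {1..s}) = card (signature (S # h) ` {1..t'})"
          using that t' by (simp add: C'_def \<kappa>_def)
      qed simp
      define R where "R = (\<Union>s\<in>C'. (\<lambda>x. greedy_answer (hard s x) S) ` box 0)"
      have finR: "finite R" unfolding R_def using fin' finite_box by auto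
      have R: "(\<lambda>x. greedy_answer (hard s x) S) ` box k' \<subseteq> R" if "s \<in> C'" for s k'
        using box_antimono[of 0 k'] that by (auto simp: R_def)
      have G: "G s = (\<Sum>r\<in>R. \<Sum>x\<in>consistent s (Suc k + m' + 1) (S # h) (r # rs).
          greedy_success (hard s x) (E s) (q r) m')" if "s \<in> C'" for s
      proof -
        let ?X = "consistent s (Suc k + m' + 1) h rs" and ?a = "\<lambda>x. greedy_answer (hard s x) S"
        have "?a ` ?X \<subseteq> R"
          using R[OF that, of "Suc k + m' + 1"] unfolding consistent_def by blast
        then have "(\<Sum>x\<in>?X. greedy_success (hard s x) (E s) (q (?a x)) m')
            = (\<Sum>r\<in>R. \<Sum>x\<in>{x \<in> ?X. ?a x = r}. greedy_success (hard s x) (E s) (q (?a x)) m')"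
          by (rule sum.group[OF finite_consistent finR, symmetric])
        also have "\<dots> = (\<Sum>r\<in>R. \<Sum>x\<in>consistent s (Suc k + m' + 1) (S # h) (r # rs).
            greedy_success (hard s x) (E s) (q r) m')"
          by (intro sum.cong refl) (auto simp: consistent_Cons)
        finally show ?thesis by (simp add: G_def Suc)
      qed
      \<comment> \<open>With the answer fixed first, all scales of the class continue with the same
        subtree \<open>q r\<close>, as the induction hypothesis requires.\<close>
      have "(\<Sum>s\<in>C'. G s) = (\<Sum>r\<in>R. \<Sum>s\<in>C'. \<Sum>x\<in>consistent s (Suc k + m' + 1) (S # h) (r # rs).
          greedy_success (hard s x) (E s) (q r) m')"
        using G by (subst sum.swap) simp
      also have "\<dots> \<le> (\<Sum>r\<in>R. ?B ^ m' * real (card (consistent t' (Suc k) (S # h) (r # rs))))"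
      proof (rule sum_mono)
        fix r
        show "(\<Sum>s\<in>C'. \<Sum>x\<in>consistent s (Suc k + m' + 1) (S # h) (r # rs).
            greedy_success (hard s x) (E s) (q r) m')
          \<le> ?B ^ m' * real (card (consistent t' (Suc k) (S # h) (r # rs)))"
        proof (rule Query.IH)
          show "disjoint_family_on E C'"
            using Query.prems(1) sub by (rule disjoint_family_on_mono[rotated])
          show "C' \<subseteq> {1..t'}" using sub max Query.prems(2) by fastforce
          show "t' \<le> n" using t' sub Query.prems(2,3) by fastforce
          show "length (S # h) + m' \<le> L" using Query.prems(5) Suc by simp
        qed (use sig in auto)
      qed
      also have "\<dots> = ?B ^ m' * real (\<Sum>r\<in>R. card (consistent t' (Suc k) (S # h) (r # rs)))"
        by (simp add: sum_distrib_left)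
      also have "\<dots> = ?B ^ m' * real (card (consistent t' (Suc k) h rs))"
        using sum_card_consistent_Cons[OF finR R[OF t']] by simp
      \<comment> \<open>With the answers to \<open>S\<close> summed out, only signatures for
        \<open>h\<close> matter; passing from \<open>t'\<close> to \<open>t\<close> spends this
        query's level of margin.\<close>
      also have "\<dots> \<le> ?B ^ m' * real (card (consistent t k h rs))"
      proof (intro mult_left_mono of_nat_mono card_consistent_le)
        show "signature h ` {1..t'} = signature h ` {1..t}" using t' sub Query.prems(4) by blast
        show "1 \<le> t'" "t' \<le> t" "t \<le> n" using t' sub Query.prems(2,3) by auto
      qed simp
      finally show ?thesis by (simp add: C'_def)
    next
      case True
      show ?thesis unfolding True by simp
    qed
    have "\<kappa> s \<le> 4 ^ L" for s
    proof -
      have "\<kappa> s \<le> 4 ^ length (S # h)" unfolding \<kappa>_def by (rule card_signature_le)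
      also have "\<dots> \<le> 4 ^ L" using Query.prems(5) Suc by (intro power_increasing) auto
      finally show ?thesis .
    qed
    then have "(\<Sum>s\<in>C. G s) = (\<Sum>c\<in>{..4 ^ L}. \<Sum>s\<in>{s \<in> C. \<kappa> s = c}. G s)"
      using fin by (intro sum.group[symmetric]) auto
    also have "\<dots> \<le> (\<Sum>c\<in>{..4 ^ L::nat}. ?B ^ m' * real (card (consistent t k h rs)))"
      by (intro sum_mono class_le)
    also have "\<dots> = ?B ^ m * real (card (consistent t k h rs))" by (simp add: Suc algebra_simps)
    finally show ?thesis by (simp add: G_def)
  qed
next
  case (Random p)
  have "finite C" using Random.prems(2) finite_subset by blast
  then show ?case
    using Random.prems finite_consistent
    by (intro greedy_success_Random_sum Random.IH) auto
qed

section \<open>Bounding the number of scales by the number of queries\<close>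

lemma card_box:
  assumes "4 * int k \<le> M"
  shows "real (card (box k)) = real_of_int (M - 4 * int k) ^ (n - 1) * (\<Prod>i\<in>{2..n}. real_of_int M ^ (n - i))"
proof -
  have "real (card {(M + 4 * int k) * M ^ (n - i)..<2 * M * M ^ (n - i)})
      = real_of_int (M - 4 * int k) * real_of_int M ^ (n - i)" for i
  proof -
    have "2 * M * M ^ (n - i) - (M + 4 * int k) * M ^ (n - i) = (M - 4 * int k) * M ^ (n - i)"
      by (simp add: algebra_simps)
    moreover have "0 \<le> (M - 4 * int k) * M ^ (n - i)"
      using assms M_ge by (intro mult_nonneg_nonneg) auto
    ultimately show ?thesis by simp
  qed
  then show ?thesis
    unfolding box_def by (simp add: card_PiE prod.distrib)
qed

text \<open>The ratio of the cardinalities is \<open>(1 - 4 * k / M) ^ (n - 1)\<close>, which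
  Bernoulli's inequality bounds from below.\<close>

lemma card_box_ge_half:
  assumes "8 * int k * int n \<le> M"
  shows "real (card (box 0)) / 2 \<le> real (card (box k))"
proof -
  have "int k * 1 \<le> int k * int n" using n_pos by (intro mult_left_mono) auto
  then have k: "4 * int k \<le> M" using assms by linarith
  define P where "P = (\<Prod>i\<in>{2..n}. real_of_int M ^ (n - i))"
  define y where "y = real_of_int (4 * int k) / real_of_int M"
  have P: "0 \<le> P" unfolding P_def using M_ge by (intro prod_nonneg) auto
  have "real_of_int (8 * int k * int n) \<le> real_of_int M" using assms by (simp only: of_int_le_iff)
  then have ny: "real n * y \<le> 1 / 2" using M_ge by (simp add: y_def field_simps)
  have y: "0 \<le> y" "y \<le> 1" using k M_ge by (auto simp: y_def)
  have "real (n - 1) * y \<le> real n * y" using y by (intro mult_right_mono) auto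
  then have "1 / 2 \<le> 1 + real (n - 1) * (- y)" using ny by simp
  also have "\<dots> \<le> (1 + - y) ^ (n - 1)" using y by (intro Bernoulli_inequality) auto
  finally have "1 / 2 * real_of_int M ^ (n - 1) \<le> (1 - y) ^ (n - 1) * real_of_int M ^ (n - 1)"
    using M_ge by (intro mult_right_mono) auto
  also have "\<dots> = real_of_int (M - 4 * int k) ^ (n - 1)"
    using M_ge by (simp add: y_def field_simps flip: power_mult_distrib)
  finally have "1 / 2 * real_of_int M ^ (n - 1) * P \<le> real_of_int (M - 4 * int k) ^ (n - 1) * P"
    using P by (intro mult_right_mono) auto
  then show ?thesis using card_box[OF k] card_box[of 0] M_ge by (simp add: P_def)
qed

text \<open>Success is at least 1/2 for each scale and each vector of \<open>box (m + 1)\<close>,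
  which is at least half of \<open>box 0\<close>; these two halves give the factor 4.\<close>

lemma number_of_scales_le:
  assumes M: "24 * int (m + 1) * int n \<le> M" and b: "\<And>i. i < b \<Longrightarrow> 2 ^ i \<le> n"
    and "approximates_support_size n A" "makes_at_most_queries n A m"
  shows "real b \<le> 4 * (4 ^ m + 1) ^ m"
proof -
  define C :: "nat set" where "C = (\<lambda>i. 2 ^ i) ` {..<b}"
  define E where "E s = {N. 3 / 4 * real s \<le> N \<and> N \<le> 4 / 3 * real s}" for s :: nat
  have card_C: "card C = b" unfolding C_def by (subst card_image) (auto simp: inj_on_def)
  have C: "C \<subseteq> {1..n}" using b by (auto simp: C_def)
  have disj: "disjoint_family_on E C"
  proof -
    \<comment> \<open>The endpoints of one interval have ratio 16/9, which is less than 2.\<close>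
    have *: "E (2 ^ i) \<inter> E (2 ^ j) = {}" if "i < j" for i j :: nat
    proof -
      have "(2::real) * 2 ^ i \<le> 2 ^ j"
        using that power_increasing[of "Suc i" j "2::real"] by simp
      then have "4 / 3 * real (2 ^ i) < 3 / 4 * real (2 ^ j)" by simp (smt (verit) zero_less_power)
      then show ?thesis unfolding E_def by force
    qed
    show ?thesis unfolding disjoint_family_on_def C_def
      using * by (auto simp: Int_commute) (metis Int_commute IntI empty_iff nat_neq_iff)
  qed
  have Mm: "real_of_int (24 * int (m + 1)) \<le> real_of_int M"
  proof -
    have "24 * int (m + 1) * 1 \<le> 24 * int (m + 1) * int n" using n_pos by (intro mult_left_mono) auto
    then show ?thesis using M by (simp only: of_int_le_iff)
  qed
  have success: "1 / 2 \<le> greedy_success (hard s x) (E s) A m"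
    if s: "s \<in> C" and x: "x \<in> box k" for s x k
  proof -
    have s1: "1 \<le> s" and sn: "s \<le> n" using C s by auto
    note set = set_pmf_hard[OF x s1 sn]
    have D: "hard s x \<in> distributions_on n" using set sn by (auto simp: distributions_on_def)
    have "2 / 3 \<le> measure_pmf.prob (run (hard s x) A) {(q, N). N \<in> E s}"
      using assms(3) D unfolding approximates_support_size_def by (auto simp: set E_def)
    also have "\<dots> \<le> greedy_success (hard s x) (E s) A m + real m * (4 / real_of_int M)"
    proof (rule success_le_greedy_success)
      show "\<forall>(q, N)\<in>set_pmf (run (hard s x) A). q \<le> m"
        using assms(4) D unfolding makes_at_most_queries_def by blast
    qed (use M_ge hard_dominated[OF x s1 sn] set in auto)
    \<comment> \<open>The factor 24 in the bound on \<open>M\<close> limits the loss to 1/6, leaving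
      2/3 - 1/6 = 1/2.\<close>
    also have "real m * (4 / real_of_int M) \<le> 1 / 6"
      using Mm M_ge by (simp add: field_simps)
    finally show ?thesis by simp
  qed
  have cons: "consistent s k [] [] = box k" for s k by (simp add: consistent_def)
  have half: "real (card (box 0)) / 2 \<le> real (card (box (m + 1)))"
  proof (rule card_box_ge_half)
    have "8 * int (m + 1) * int n \<le> 24 * int (m + 1) * int n" by (intro mult_right_mono) auto
    then show "8 * int (m + 1) * int n \<le> M" using M by (rule order_trans)
  qed
  have pos: "0 < real (card (box 0))"
    using card_box[of 0] M_ge by (simp add: prod_pos)
  have "real b * (real (card (box 0)) / 4) \<le> real b * (real (card (box (m + 1))) / 2)"
    using half by (intro mult_left_mono) auto
  also have "\<dots> = (\<Sum>s\<in>C. \<Sum>x\<in>box (m + 1). 1 / 2)" using card_C by simp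
  also have "\<dots> \<le> (\<Sum>s\<in>C. \<Sum>x\<in>box (m + 1). greedy_success (hard s x) (E s) A m)"
    by (intro sum_mono success)
  \<comment> \<open>Before any query all signatures are empty, so all scales start in a single
    class.\<close>
  also have "\<dots> \<le> (4 ^ m + 1) ^ m * real (card (box 0))"
    using sum_greedy_success_le[OF disj C, where h = "[]" and m = m and L = m and k = 0 and rs = "[]" and A = A]
      C by (force simp: cons signature_def)
  finally have "real b * real (card (box 0)) \<le> (4 * (4 ^ m + 1) ^ m) * real (card (box 0))"
    by simp
  then show ?thesis using pos by (simp only: mult_le_cancel_right_pos)
qed

end

section \<open>From the number of scales to the triple logarithm\<close>

lemma ln_le_of_approximates_support_size:
  assumes "1 \<le> n" "approximates_support_size n A" "makes_at_most_queries n A m"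
  shows "ln (real n) \<le> 4 * (4 ^ m + 1) ^ m"
proof -
  define b where "b = nat \<lfloor>log 2 (real n)\<rfloor> + 1"
  have log_nonneg: "0 \<le> log 2 (real n)" using assms(1) by simp
  have b: "2 ^ i \<le> n" if "i < b" for i
  proof -
    have "real i \<le> log 2 (real n)" using that log_nonneg unfolding b_def by linarith
    then have "2 powr real i \<le> real n" using assms(1) by (simp add: le_log_iff)
    then show ?thesis by (simp add: powr_realpow)
  qed
  interpret hidden_tail n "24 * int (m + 1) * int n"
  proof
    have "24 * 1 * 1 \<le> 24 * int (m + 1) * int n" using assms(1) by (intro mult_mono) auto
    then show "4 \<le> 24 * int (m + 1) * int n" by simp
  qed (fact assms(1))
  have "ln (real n) \<le> log 2 (real n)"
    using assms(1) ln_2_less_1 by (simp add: log_def field_simps mult_left_le)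
  also have "\<dots> \<le> real b" using log_nonneg unfolding b_def by linarith
  also have "\<dots> \<le> 4 * (4 ^ m + 1) ^ m"
    by (rule number_of_scales_le[OF order_refl b assms(2,3)])
  finally show ?thesis .
qed

theorem theorem3p1:
  shows "\<exists>c>0. \<exists>n0::nat. \<forall>n\<ge>n0. \<forall>A m.
           algorithm_on n A \<longrightarrow> approximates_support_size n A \<longrightarrow> makes_at_most_queries n A m \<longrightarrow>
           real m \<ge> c * ln (ln (ln (real n)))"
proof -
  have "real m \<ge> 1 / 4 * ln (ln (ln (real n)))"
    if n: "nat \<lceil>exp (5::real)\<rceil> \<le> n" and "approximates_support_size n A" "makes_at_most_queries n A m"
    for n A m
  proof -
    have "exp 5 \<le> real n" using n by linarith
    then have ln5: "5 \<le> ln (real n)" by (metis exp_gt_zero less_le_trans ln_ge_iff)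
    have "1 \<le> n" using \<open>exp 5 \<le> real n\<close> by (metis exp_gt_zero less_le_trans less_one not_le of_nat_0 less_irrefl)
    then have bound: "ln (real n) \<le> 4 * (4 ^ m + 1) ^ m"
      using that(2,3) by (rule ln_le_of_approximates_support_size)
    then have m: "1 \<le> m" using ln5 by (cases m) auto
    have e2: "5 \<le> exp (2::real)" using exp_lower_Taylor_quadratic[of 2] by simp
    \<comment> \<open>Base 5 absorbs the summand 1, and \<open>5 <= exp 2\<close> yields an
      exponential, so two logarithms leave a quadratic in \<open>m\<close>.\<close>
    have "(4::real) ^ m + 1 \<le> 5 ^ m" using m
    proof (induction m rule: nat_induct_at_least)
      case (Suc m)
      then show ?case
        using zero_le_power[of "4::real" m, OF zero_le_numeral] unfolding power_Suc by linarith
    qed simp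
    also have "\<dots> \<le> exp 2 ^ m" using e2 by (intro power_mono) auto
    finally have "(4 ^ m + 1) ^ m \<le> (exp (2::real) ^ m) ^ m" by (intro power_mono) auto
    also have "\<dots> = exp (2 * real m ^ 2)"
      by (simp add: power2_eq_square mult_ac flip: exp_of_nat_mult power_mult)
    finally have "ln (real n) \<le> exp 2 * exp (2 * real m ^ 2)"
      using bound e2 by (intro order_trans[OF bound] mult_mono) auto
    also have "\<dots> = exp (2 + 2 * real m ^ 2)" by (simp add: exp_add)
    also have "\<dots> \<le> exp (4 * real m ^ 2)" using m by simp
    finally have "ln (ln (real n)) \<le> 4 * real m ^ 2"
      using ln5 by (subst exp_le_cancel_iff[symmetric]) simp
    \<comment> \<open>Bounding \<open>2 * m\<close> by its exponential makes the third logarithm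
      linear in \<open>m\<close>, whence the constant 1/4.\<close>
    also have "\<dots> = (2 * real m) ^ 2" by (simp add: power2_eq_square)
    also have "\<dots> \<le> exp (2 * real m) ^ 2"
      using exp_ge_add_one_self[of "2 * real m"] by (intro power_mono) linarith+
    also have "\<dots> = exp (4 * real m)" by (simp flip: exp_of_nat_mult)
    finally have "ln (ln (ln (real n))) \<le> 4 * real m"
      using ln5 by (subst exp_le_cancel_iff[symmetric]) simp
    then show ?thesis by simp
  qed
  then show ?thesis by (intro exI[of _ "1 / 4"] conjI exI[of _ "nat \<lceil>exp (5::real)\<rceil>"] allI impI) auto
qed

end
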